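(* (Direct sum.) Let $\mathcal B$ be a deterministic decision tree on inputs from $(\{0,1\}^m)^t$ and let $\mathcal Q$ be a consistent distribution over pairs $(\mu_0,\mu_1)$ of distributions on $\{0,1\}^m$. If $(\mathcal B,\mathcal Q)$ is full, then for every $z\in\{0,1\}^t$, \[\sum_{i=1}^t\mathbb E[\mathcal N_i(\mathcal B,z,\mathcal Q)]\ \ge\ t\cdot\min_{\mathcal C}\chi(\mathcal C,\mathcal Q),\] where the minimum is over deterministic decision trees $\mathcal C$ on inputs from $\{0,1\}^m$ such that $(\mathcal C,\mathcal Q)$ is full.
   Context: Inputs $x\in(\{0,1\}^m)^t$ are written $x=(x_1,\dots,x_t)$ with $x_i=(x_i^{(1)},\dots,x_i^{(m)})$. A deterministic decision tree queries at each internal node $v$ a single bit and moves to $v_0$ or $v_1$; leaves need not be labelled; each node is identified with the subcube of inputs reaching it, $v=v^{(1)}\times\dots\times v^{(t)}$. $\mathcal Q$ is consistent if the union of supports of first components of pairs in $\mathrm{supp}(\mathcal Q)$ is disjoint from the union of supports of second components. Query process $\mathcal P(\mathcal B,\mathcal Q)$ on $z\in\{0,1\}^t$: for each $k$ set $\mathsf{QUERY}_k\gets0$, $\mathsf N_k\gets0$, sample $(\mu_0^{(k)},\mu_1^{(k)})$ independently from $\mathcal Q$. Start at the root $v$. While $v$ is not a leaf: let $x_i^{(j)}$ be queried at $v$ and $q_b=\Pr_{x_i\sim\mu_b^{(i)}}[x_i^{(j)}=0\mid x_i\in v^{(i)}]$. If $\mathsf{QUERY}_i=0$: draw a fresh uniform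 $r\in[0,1]$; if $r<\min_bq_b$ go to $v_0$; else if $r>\max_bq_b$ go to $v_1$; otherwise query $z_i$, set $\mathsf{QUERY}_i\gets1$, and go to $v_0$ if $r\le q_{z_i}$, else to $v_1$; then increment $\mathsf N_i$. If $\mathsf{QUERY}_i=1$: go to $v_0$ with probability $q_{z_i}$, else to $v_1$. The random variable $\mathcal N_i(\mathcal B,z,\mathcal Q)$ is the final value of $\mathsf N_i$. The pair $(\mathcal B,\mathcal Q)$ (for $\mathcal B$ on $(\{0,1\}^m)^t$) is full if for every $z\in\{0,1\}^t$ and every $i$, $\mathcal P(\mathcal B,\mathcal Q)$ on $z$ queries $z_i$ with probability $1$. For a tree $\mathcal C$ on $\{0,1\}^m$ (querying index $q(v)$ at $v$, parent $\pi(v)$, $d_{\mathcal C}(v)$ = number of vertices on root-to-$v$ path, root depth $1$) and a pair $(\mu_0,\mu_1)$: $p_b(v)=\Pr_{x\sim\mu_b}[x_{q(v)}=0\mid x\in v]$, $\Delta(v)=|p_0(v)-p_1(v)|$, $R(\text{root})=1$, $R(v)=R(\pi(v))\min_b\Pr_{x\sim\mu_b}[x\in v\mid x\in\pi(v)]$ (terms with $R(v)=0$ are $0$). $(\mathcal C,(\mu_0,\mu_1))$ is full if $\sum_v\Delta(v)R(v)=1$, and then $\chi(\mathcal C,(\mu_0,\mu_1))=\sum_vd_{\mathcal C}(v)\Delta(v)R(v)$. $(\mathcal C,\mathcal Q)$ is full if $(\mathcal C,(\mu_0,\mu_1))$ is full for every pair in $\mathrm{supp}(\mathcal Q)$, and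 then $\chi(\mathcal C,\mathcal Q)=\mathbb E_{(\mu_0,\mu_1)\sim\mathcal Q}\chi(\mathcal C,(\mu_0,\mu_1))$. *)

theory Defs
  imports "HOL-Probability.Probability"
begin

text \<open>
  A bit is a Boolean (\<open>False\<close> is 0, \<open>True\<close> is 1), \<open>{0,1}^m\<close> is \<^typ>\<open>'m::finite \<Rightarrow> bool\<close>, and a
  decision tree on \<open>({0,1}^m)^t\<close> queries indices of type \<^typ>\<open>'t::finite \<times> 'm::finite\<close>.
  In \<open>Query q T0 T1\<close> the subtree \<open>Tb\<close> is entered when the answer to the query \<open>q\<close> is \<open>b\<close>.
  No restriction is placed on a bit being queried repeatedly along a path.
\<close>

datatype 'q decision_tree = Leaf | Query 'q "'q decision_tree" "'q decision_tree"

type_synonym 'm dist = "('m \<Rightarrow> bool) pmf"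

definition side :: "'a \<times> 'a \<Rightarrow> bool \<Rightarrow> 'a" where
  "side p b = (if b then snd p else fst p)"

definition consistent :: "('m dist \<times> 'm dist) pmf \<Rightarrow> bool" where
  "consistent Q \<longleftrightarrow>
     (\<Union>p\<in>set_pmf Q. set_pmf (fst p)) \<inter> (\<Union>p\<in>set_pmf Q. set_pmf (snd p)) = {}"

text \<open>
  Conditioning on an event of probability 0 yields the value 0. Below this happens only in terms
  with \<open>R_at C P v = 0\<close> and at nodes that the query process reaches with probability 0.
\<close>

definition prob_zero :: "'m dist \<Rightarrow> 'm \<Rightarrow> ('m \<Rightarrow> bool) set \<Rightarrow> real" where
  "prob_zero \<mu> j V = \<P>(x in measure_pmf \<mu>. \<not> x j \<bar> x \<in> V)"


subsection \<open>The query process\<close>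

text \<open>
  In \<open>run z \<mu> T V QUERY N\<close> the current node \<open>v\<close> is the root of \<open>T\<close>, \<open>V i\<close> is the factor of the
  subcube \<open>v\<close> in block \<open>i\<close>, and \<open>\<mu> k\<close> is the pair sampled for block \<open>k\<close>. The outcome consists
  of the final values of \<open>QUERY\<close> and \<open>N\<close>; since \<open>QUERY i\<close> is never reset, its final value tells
  whether \<open>z i\<close> was queried.
\<close>

fun run :: "('t \<Rightarrow> bool) \<Rightarrow> ('t \<Rightarrow> 'm dist \<times> 'm dist) \<Rightarrow> ('t \<times> 'm) decision_tree \<Rightarrow>
    ('t \<Rightarrow> ('m \<Rightarrow> bool) set) \<Rightarrow> ('t \<Rightarrow> bool) \<Rightarrow> ('t \<Rightarrow> nat) \<Rightarrow>
    (('t \<Rightarrow> bool) \<times> ('t \<Rightarrow> nat)) measure" where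
  "run z \<mu> Leaf V QUERY N = return (count_space UNIV) (QUERY, N)"
| "run z \<mu> (Query (i, j) T0 T1) V QUERY N =
    (let q = (\<lambda>b. prob_zero (side (\<mu> i) b) j (V i));
         go0 = run z \<mu> T0 (V(i := {x \<in> V i. \<not> x j}));
         go1 = run z \<mu> T1 (V(i := {x \<in> V i. x j}))
     in if \<not> QUERY i then
          (let N' = N(i := Suc (N i)) in
           uniform_measure lborel {0..1::real} \<bind> (\<lambda>r.
             if r < min (q False) (q True) then go0 QUERY N'
             else if r > max (q False) (q True) then go1 QUERY N'
             else if r \<le> q (z i) then go0 (QUERY(i := True)) N'
             else go1 (QUERY(i := True)) N'))
        else
          measure_pmf (bernoulli_pmf (q (z i))) \<bind> (\<lambda>zero.
            if zero then go0 QUERY N else go1 QUERY N))"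

definition query_process ::
    "('t::finite \<times> 'm) decision_tree \<Rightarrow> ('m dist \<times> 'm dist) pmf \<Rightarrow> ('t \<Rightarrow> bool) \<Rightarrow>
     (('t \<Rightarrow> bool) \<times> ('t \<Rightarrow> nat)) measure" where
  "query_process B Q z =
     measure_pmf (Pi_pmf UNIV undefined (\<lambda>_. Q)) \<bind>
       (\<lambda>\<mu>. run z \<mu> B (\<lambda>_. UNIV) (\<lambda>_. False) (\<lambda>_. 0))"

definition process_full :: "('t::finite \<times> 'm) decision_tree \<Rightarrow> ('m dist \<times> 'm dist) pmf \<Rightarrow> bool" where
  "process_full B Q \<longleftrightarrow> (\<forall>z i. \<P>((QUERY, N) in query_process B Q z. QUERY i) = 1)"

definition expected_N ::
    "('t::finite \<times> 'm) decision_tree \<Rightarrow> ('t \<Rightarrow> bool) \<Rightarrow> ('m dist \<times> 'm dist) pmf \<Rightarrow> 't \<Rightarrow> real" where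
  "expected_N B z Q i = (LINT (QUERY, N)|query_process B Q z. real (N i))"


subsection \<open>Conflict complexity\<close>

text \<open>
  A vertex of a tree is given by the list of answers on the path from the root to it, so its
  parent is \<^const>\<open>butlast\<close> of it.
\<close>

fun internal_vertices :: "'q decision_tree \<Rightarrow> bool list set" where
  "internal_vertices Leaf = {}"
| "internal_vertices (Query q T0 T1) =
     insert [] ((#) False ` internal_vertices T0 \<union> (#) True ` internal_vertices T1)"

fun query_at :: "'q decision_tree \<Rightarrow> bool list \<Rightarrow> 'q" where
  "query_at (Query q T0 T1) [] = q"
| "query_at (Query q T0 T1) (b # v) = query_at (if b then T1 else T0) v"
| "query_at Leaf v = undefined"

fun subcube :: "'m decision_tree \<Rightarrow> bool list \<Rightarrow> ('m \<Rightarrow> bool) set" where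
  "subcube T [] = UNIV"
| "subcube (Query j T0 T1) (b # v) = {x. x j = b} \<inter> subcube (if b then T1 else T0) v"
| "subcube Leaf (b # v) = {}"

definition depth :: "bool list \<Rightarrow> nat" where
  "depth v = length v + 1"

definition p_at :: "'m decision_tree \<Rightarrow> 'm dist \<Rightarrow> bool list \<Rightarrow> real" where
  "p_at C \<mu> v = prob_zero \<mu> (query_at C v) (subcube C v)"

definition Delta :: "'m decision_tree \<Rightarrow> 'm dist \<times> 'm dist \<Rightarrow> bool list \<Rightarrow> real" where
  "Delta C P v = \<bar>p_at C (fst P) v - p_at C (snd P) v\<bar>"

function R_at :: "'m decision_tree \<Rightarrow> 'm dist \<times> 'm dist \<Rightarrow> bool list \<Rightarrow> real" where
  "R_at C P v =
     (if v = [] then 1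
      else R_at C P (butlast v) *
        min (\<P>(x in measure_pmf (fst P). x \<in> subcube C v \<bar> x \<in> subcube C (butlast v)))
            (\<P>(x in measure_pmf (snd P). x \<in> subcube C v \<bar> x \<in> subcube C (butlast v))))"
  by pat_completeness auto
termination
  by (relation "Wellfounded.measure (\<lambda>(C, P, v). length v)") auto

declare R_at.simps [simp del]

definition pair_full :: "'m decision_tree \<Rightarrow> 'm dist \<times> 'm dist \<Rightarrow> bool" where
  "pair_full C P \<longleftrightarrow> (\<Sum>v\<in>internal_vertices C. Delta C P v * R_at C P v) = 1"

definition pair_chi :: "'m decision_tree \<Rightarrow> 'm dist \<times> 'm dist \<Rightarrow> real" where
  "pair_chi C P = (\<Sum>v\<in>internal_vertices C. real (depth v) * Delta C P v * R_at C P v)"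

definition full :: "'m decision_tree \<Rightarrow> ('m dist \<times> 'm dist) pmf \<Rightarrow> bool" where
  "full C Q \<longleftrightarrow> (\<forall>P\<in>set_pmf Q. pair_full C P)"

definition chi :: "'m decision_tree \<Rightarrow> ('m dist \<times> 'm dist) pmf \<Rightarrow> real" where
  "chi C Q = measure_pmf.expectation Q (pair_chi C)"

end

theory Submission
  imports Defs
begin

text \<open>
  Fix \<open>z\<close> and a block \<open>i\<close>. In every other block \<open>k\<close> the process moves exactly as if
  \<open>x\<^sub>k\<close> were sampled from \<open>\<mu>\<close> with index \<open>z\<^sub>k\<close>, so restricting \<open>B\<close> to these samples yields a random
  tree \<open>C\<close> on block \<open>i\<close>, independent of the pair drawn for that block. Until \<open>z\<^sub>i\<close> is queried, the
  moves in block \<open>i\<close> follow \<open>C\<close> and do not depend on \<open>z\<^sub>i\<close>; the query happens at vertex \<open>v\<close> of \<open>C\<close>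
  with probability \<open>\<Delta>(v) R(v)\<close>. Hence fullness of the process forces almost every \<open>C\<close> to be full, and
  the expectation of \<open>N\<^sub>i\<close> is the average of \<open>\<chi>(C, Q)\<close>, which is at least the minimum for each \<open>i\<close>.
  The minimum is attained because removing queries whose answer is already determined does not
  increase \<open>\<chi>\<close> and leaves only finitely many trees.
\<close>

section \<open>Images of the uniform distribution\<close>

text \<open>The process sees its real draw only through countably many outcomes, so their law is
  kept as a \<open>pmf\<close>. The definition is meaningful for Borel \<open>h\<close> with
  countable codomain.\<close>

definition uniform_image :: "(real \<Rightarrow> 'a) \<Rightarrow> 'a pmf" where
  "uniform_image h = Abs_pmf (distr (uniform_measure lborel {0..1}) (count_space UNIV) h)"

lemma prob_space_uniform_unit: "prob_space (uniform_measure lborel {0..1::real})"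
  by (rule prob_space_uniform_measure) auto

text \<open>A probability measure on a countable type gives all its mass to atoms, which is the
  condition for inverting \<open>Abs_pmf\<close>.\<close>

lemma measure_uniform_image:
  fixes h :: "real \<Rightarrow> 'a::countable"
  assumes [measurable]: "h \<in> borel \<rightarrow>\<^sub>M count_space UNIV"
  shows "measure_pmf (uniform_image h) =
    distr (uniform_measure lborel {0..1}) (count_space UNIV) h" (is "_ = ?D")
proof -
  interpret U: prob_space "uniform_measure lborel {0..1::real}"
    by (rule prob_space_uniform_unit)
  interpret D: prob_space ?D
    by (rule U.prob_space_distr) simp
  have "AE x in ?D. measure ?D {x} \<noteq> 0"
    by (subst D.AE_support_countable) (auto intro!: exI[of _ UNIV])
  then show ?thesis
    unfolding uniform_image_def using D.prob_space_axioms
    by (intro Abs_pmf_inverse) auto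
qed

lemma pmf_uniform_image:
  fixes h :: "real \<Rightarrow> 'a::countable"
  assumes [measurable]: "h \<in> borel \<rightarrow>\<^sub>M count_space UNIV"
  shows "pmf (uniform_image h) y = measure lborel ({0..1} \<inter> h -` {y})"
proof -
  have [measurable]: "h -` {y} \<in> sets borel"
    using measurable_sets[OF assms, of "{y}"] by simp
  have "pmf (uniform_image h) y = measure (uniform_measure lborel {0..1}) (h -` {y})"
    by (simp add: pmf.rep_eq measure_uniform_image measure_distr)
  also have "\<dots> = measure lborel ({0..1} \<inter> h -` {y})"
    by (subst measure_uniform_measure) auto
  finally show ?thesis .
qed

lemma bind_uniform_image:
  fixes h :: "real \<Rightarrow> 'a::countable"
  assumes [measurable]: "h \<in> borel \<rightarrow>\<^sub>M count_space UNIV"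
  shows "uniform_measure lborel {0..1} \<bind> (\<lambda>r. measure_pmf (g (h r))) =
    measure_pmf (bind_pmf (uniform_image h) g)"
  unfolding measure_pmf_bind measure_uniform_image[OF assms]
  by (subst bind_distr[where K = "count_space UNIV"])
    (auto simp: space_subprob_algebra intro: measure_pmf.subprob_space_axioms)

lemma map_uniform_image:
  fixes h :: "real \<Rightarrow> 'a::countable" and g :: "'a \<Rightarrow> 'b::countable"
  assumes [measurable]: "h \<in> borel \<rightarrow>\<^sub>M count_space UNIV"
  shows "map_pmf g (uniform_image h) = uniform_image (\<lambda>r. g (h r))"
proof -
  have "measure_pmf (map_pmf g (uniform_image h)) = measure_pmf (uniform_image (\<lambda>r. g (h r)))"
    by (simp add: map_pmf_rep_eq measure_uniform_image distr_distr comp_def)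
  then show ?thesis
    by (simp add: measure_pmf_inject)
qed

lemma uniform_image_threshold:
  assumes "0 \<le> p" "p \<le> 1"
  shows "uniform_image (\<lambda>r. r \<le> p) = bernoulli_pmf p"
proof (rule pmf_eqI)
  fix b
  have h: "(\<lambda>r::real. r \<le> p) \<in> borel \<rightarrow>\<^sub>M count_space UNIV"
    by measurable
  have "{0..1} \<inter> (\<lambda>r. r \<le> p) -` {b} = (if b then {0..p} else {p<..1})"
    using assms by (intro set_eqI, cases b) auto
  then show "pmf (uniform_image (\<lambda>r. r \<le> p)) b = pmf (bernoulli_pmf p) b"
    using assms unfolding pmf_uniform_image[OF h] by (cases b) simp_all
qed

text \<open>One step of the process in a block that is still unqueried: \<open>Some b\<close> means that the
  answer \<open>b\<close> was determined without conflict, \<open>None\<close> that the block is queried.\<close>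

definition free_step :: "real \<Rightarrow> real \<Rightarrow> bool option pmf" where
  "free_step p q =
     uniform_image (\<lambda>r. if r < min p q then Some False else if r > max p q then Some True else None)"

text \<open>The values are interval lengths. The conflict interval has length
  \<open>\<bar>p - q\<bar>\<close>, which is how \<open>Delta\<close> enters.\<close>

lemma pmf_free_step:
  assumes "0 \<le> p" "p \<le> 1" "0 \<le> q" "q \<le> 1"
  shows "pmf (free_step p q) (Some False) = min p q"
    and "pmf (free_step p q) (Some True) = 1 - max p q"
    and "pmf (free_step p q) None = \<bar>p - q\<bar>"
proof -
  let ?h = "\<lambda>r. if r < min p q then Some False else if r > max p q then Some True else None"
  have h: "?h \<in> borel \<rightarrow>\<^sub>M count_space UNIV"
    by measurable
  have "{0..1} \<inter> ?h -` {Some False} = {0..<min p q}" "{0..1} \<inter> ?h -` {Some True} = {max p q<..1}"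
    "{0..1} \<inter> ?h -` {None} = {min p q..max p q}"
    using assms by (auto split: if_splits)
  then show "pmf (free_step p q) (Some False) = min p q"
    "pmf (free_step p q) (Some True) = 1 - max p q" "pmf (free_step p q) None = \<bar>p - q\<bar>"
    using assms unfolding free_step_def pmf_uniform_image[OF h] by auto
qed


section \<open>The query process as a discrete distribution\<close>

\<comment> \<open>\<open>fun_upd_apply\<close> would turn the updated arguments below into conditional abstractions, to which the
  induction hypotheses no longer apply.\<close>
declare fun_upd_apply [simp del] fun_upd_same [simp] fun_upd_other [simp]

text \<open>One draw decides both whether it falls into the conflict interval and whether the move
  goes to the 0-child; \<open>s\<close> stands for the threshold belonging to the true bit of
  \<open>z\<close>.\<close>

definition query_step :: "real \<Rightarrow> real \<Rightarrow> real \<Rightarrow> (bool \<times> bool) pmf" where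
  "query_step p q s = uniform_image (\<lambda>r. (min p q \<le> r \<and> r \<le> max p q, r \<le> s))"

text \<open>If the query flag is ignored, the move has the law of an answer sampled from the
  distribution selected by \<open>z\<close>.\<close>

lemma map_snd_query_step:
  assumes "0 \<le> s" "s \<le> 1"
  shows "map_pmf snd (query_step p q s) = bernoulli_pmf s"
  unfolding query_step_def by (subst map_uniform_image) (auto simp: uniform_image_threshold assms)

text \<open>As \<open>s\<close> is one of the two thresholds, a draw outside the conflict interval
  lies on the same side of both. Without the direction of a conflicting move, the bit of
  \<open>z\<close> therefore leaves no trace.\<close>

lemma map_query_step_eq_free_step:
  assumes "s \<in> {p, q}"
  shows "map_pmf (\<lambda>(c, zero). if c then None else Some (\<not> zero)) (query_step p q s) = free_step p q"
proof -
  have "(\<lambda>r. case (min p q \<le> r \<and> r \<le> max p q, r \<le> s) of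
      (c, zero) \<Rightarrow> if c then None else Some (\<not> zero)) =
    (\<lambda>r. if r < min p q then Some False else if r > max p q then Some True else None)"
    using assms by (auto simp: fun_eq_iff)
  then show ?thesis
    unfolding query_step_def free_step_def by (subst map_uniform_image) auto
qed

fun run_pmf :: "('t \<Rightarrow> bool) \<Rightarrow> ('t \<Rightarrow> 'm dist \<times> 'm dist) \<Rightarrow> ('t \<times> 'm) decision_tree \<Rightarrow>
    ('t \<Rightarrow> ('m \<Rightarrow> bool) set) \<Rightarrow> ('t \<Rightarrow> bool) \<Rightarrow> ('t \<Rightarrow> nat) \<Rightarrow>
    (('t \<Rightarrow> bool) \<times> ('t \<Rightarrow> nat)) pmf" where
  "run_pmf z \<mu> Leaf V QUERY N = return_pmf (QUERY, N)"
| "run_pmf z \<mu> (Query (i, j) T0 T1) V QUERY N =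
    (let q = (\<lambda>b. prob_zero (side (\<mu> i) b) j (V i));
         go = (\<lambda>zero. if zero then run_pmf z \<mu> T0 (V(i := {x \<in> V i. \<not> x j}))
                      else run_pmf z \<mu> T1 (V(i := {x \<in> V i. x j})))
     in if \<not> QUERY i then
          query_step (q False) (q True) (q (z i)) \<bind>
            (\<lambda>(c, zero). go zero (QUERY(i := c)) (N(i := Suc (N i))))
        else bernoulli_pmf (q (z i)) \<bind> (\<lambda>zero. go zero QUERY N))"

lemma run_eq_run_pmf: "run z \<mu> T V QUERY N = measure_pmf (run_pmf z \<mu> T V QUERY N)"
proof (induction T arbitrary: V QUERY N)
  case Leaf
  then show ?case by (simp add: return_pmf.rep_eq)
next
  case (Query qu T0 T1)
  obtain i j where qu: "qu = (i, j)" by force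
  let ?q = "\<lambda>b. prob_zero (side (\<mu> i) b) j (V i)"
  let ?go0 = "run_pmf z \<mu> T0 (V(i := {x \<in> V i. \<not> x j}))"
  let ?go1 = "run_pmf z \<mu> T1 (V(i := {x \<in> V i. x j}))"
  show ?case
  proof (cases "QUERY i")
    case True
    have "(if zero then run z \<mu> T0 (V(i := {x \<in> V i. \<not> x j})) QUERY N
        else run z \<mu> T1 (V(i := {x \<in> V i. x j})) QUERY N) =
      measure_pmf ((if zero then ?go0 else ?go1) QUERY N)" for zero
      by (cases zero) (simp_all only: if_True if_False Query.IH)
    with True show ?thesis
      by (simp only: qu run.simps run_pmf.simps Let_def measure_pmf_bind not_True_eq_False if_False)
  next
    case False
    let ?N = "N(i := Suc (N i))"
    let ?h = "\<lambda>r. (min (?q False) (?q True) \<le> r \<and> r \<le> max (?q False) (?q True), r \<le> ?q (z i))"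
    let ?g = "\<lambda>(c, zero). (if zero then ?go0 else ?go1) (QUERY(i := c)) ?N"
    \<comment> \<open>Without a conflict \<open>run\<close> leaves \<open>QUERY\<close> alone,
      whereas \<open>run_pmf\<close> writes \<open>False\<close> over \<open>False\<close>.\<close>
    have upd: "QUERY(i := False) = QUERY"
      using False by (simp add: fun_upd_idem)
    \<comment> \<open>Hence the test \<open>r \<le> q (z i)\<close> gives the right direction below
      the minimum and above the maximum as well.\<close>
    have q: "?q (z i) \<in> {?q False, ?q True}"
      by (cases "z i") auto
    have h: "?h \<in> borel \<rightarrow>\<^sub>M count_space UNIV"
      by measurable
    have "run z \<mu> (Query qu T0 T1) V QUERY N =
      uniform_measure lborel {0..1} \<bind> (\<lambda>r. measure_pmf (?g (?h r)))"
      unfolding qu run.simps Let_def using False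
    proof (simp only: if_True not_False_eq_True, intro arg_cong[where f = "bind _"] ext, goal_cases)
      case (1 r)
      let ?lo = "min (?q False) (?q True)" and ?hi = "max (?q False) (?q True)"
      consider (lo) "r < ?lo" | (hi) "\<not> r < ?lo" "r > ?hi" | (mid) "\<not> r < ?lo" "\<not> r > ?hi"
        by blast
      then show ?case
      proof cases
        case lo
        then have "?h r = (False, True)" using q by auto
        with lo show ?thesis by (simp only: if_True prod.case Query.IH upd)
      next
        case hi
        then have "?h r = (False, False)" using q by auto
        with hi show ?thesis by (simp only: if_True if_False prod.case Query.IH upd)
      next
        case mid
        then have "?h r = (True, r \<le> ?q (z i))" by auto
        with mid show ?thesis
          by (cases "r \<le> ?q (z i)") (simp_all only: if_True if_False prod.case Query.IH)
      qed
    qed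
    also have "\<dots> = measure_pmf (run_pmf z \<mu> (Query qu T0 T1) V QUERY N)"
      unfolding bind_uniform_image[OF h] using False by (simp add: qu Let_def query_step_def)
    finally show ?thesis .
  qed
qed

definition process_pmf ::
    "('t::finite \<times> 'm) decision_tree \<Rightarrow> ('m dist \<times> 'm dist) pmf \<Rightarrow> ('t \<Rightarrow> bool) \<Rightarrow>
     (('t \<Rightarrow> bool) \<times> ('t \<Rightarrow> nat)) pmf" where
  "process_pmf B Q z = Pi_pmf UNIV undefined (\<lambda>_. Q) \<bind>
     (\<lambda>\<mu>. run_pmf z \<mu> B (\<lambda>_. UNIV) (\<lambda>_. False) (\<lambda>_. 0))"

lemma query_process_eq_process_pmf: "query_process B Q z = measure_pmf (process_pmf B Q z)"
  by (simp add: query_process_def process_pmf_def measure_pmf_bind run_eq_run_pmf)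


section \<open>Restriction to a single block\<close>

text \<open>The random tree obtained from \<open>T\<close> by answering the queries outside block \<open>i\<close> according to
  independent samples from \<open>\<mu>\<^sub>z\<close>; a sample path of the process visits only one branch of a query
  in block \<open>i\<close>, so the two subtrees there may be drawn independently.\<close>

fun restricted_tree :: "('t \<Rightarrow> bool) \<Rightarrow> ('t \<Rightarrow> 'm dist \<times> 'm dist) \<Rightarrow> 't \<Rightarrow>
    ('t \<times> 'm) decision_tree \<Rightarrow> ('t \<Rightarrow> ('m \<Rightarrow> bool) set) \<Rightarrow> 'm decision_tree pmf" where
  "restricted_tree z \<mu> i Leaf V = return_pmf Leaf"
| "restricted_tree z \<mu> i (Query (k, j) T0 T1) V =
    (if k = i then
       restricted_tree z \<mu> i T0 V \<bind> (\<lambda>C0. restricted_tree z \<mu> i T1 V \<bind>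
         (\<lambda>C1. return_pmf (Query j C0 C1)))
     else bernoulli_pmf (prob_zero (side (\<mu> k) (z k)) j (V k)) \<bind>
       (\<lambda>zero. if zero then restricted_tree z \<mu> i T0 (V(k := {x \<in> V k. \<not> x j}))
               else restricted_tree z \<mu> i T1 (V(k := {x \<in> V k. x j}))))"

text \<open>Only the factors of blocks other than \<open>i\<close> are ever read.\<close>

lemma restricted_tree_upd_cube [simp]:
  "restricted_tree z \<mu> i T (V(i := W)) = restricted_tree z \<mu> i T V"
proof (induction T arbitrary: V)
  case (Query qu T0 T1)
  obtain k j where qu: "qu = (k, j)" by force
  show ?case
  proof (cases "k = i")
    case True
    then show ?thesis by (simp add: qu Query.IH)
  next
    case False
    then have "V(i := W, k := A) = V(k := A, i := W)" for A
      by (simp add: fun_upd_twist)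
    with False show ?thesis by (simp add: qu Query.IH cong: if_cong)
  qed
qed simp

text \<open>The pair of block \<open>i\<close> is never read; this makes the random tree independent
  of that pair.\<close>

lemma restricted_tree_upd_pair [simp]:
  "restricted_tree z (\<mu>(i := P)) i T V = restricted_tree z \<mu> i T V"
proof (induction T arbitrary: V)
  case (Query qu T0 T1)
  obtain k j where qu: "qu = (k, j)" by force
  show ?case
    by (cases "k = i") (simp_all add: qu Query.IH cong: if_cong)
qed simp

text \<open>The process as seen from one block, stopped at its conflict, after which flag and
  counter stay fixed. The conflicting query itself is counted.\<close>

fun conflict_run :: "'m dist \<times> 'm dist \<Rightarrow> 'm decision_tree \<Rightarrow> ('m \<Rightarrow> bool) set \<Rightarrow> nat \<Rightarrow>
    (bool \<times> nat) pmf" where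
  "conflict_run P Leaf V n = return_pmf (False, n)"
| "conflict_run P (Query j C0 C1) V n =
    free_step (prob_zero (fst P) j V) (prob_zero (snd P) j V) \<bind> (\<lambda>s. case s of
        None \<Rightarrow> return_pmf (True, Suc n)
      | Some b \<Rightarrow> if b then conflict_run P C1 {x \<in> V. x j} (Suc n)
                  else conflict_run P C0 {x \<in> V. \<not> x j} (Suc n))"

section \<open>The law of the flag and the counter of one block\<close>

lemma cond_prob_bounds:
  "0 \<le> \<P>(x in measure_pmf \<mu>. A x \<bar> x \<in> V)" "\<P>(x in measure_pmf \<mu>. A x \<bar> x \<in> V) \<le> 1"
  unfolding cond_prob_def
  by (auto intro!: divide_le_eq_1_pos[THEN iffD2] measure_pmf.finite_measure_mono
      simp: divide_le_eq_1 measure_nonneg less_le)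

lemma prob_zero_bounds: "0 \<le> prob_zero \<mu> j V" "prob_zero \<mu> j V \<le> 1"
  by (simp_all add: prob_zero_def cond_prob_bounds)

text \<open>The flag is never reset and the counter grows only while the flag is unset, so all later
  moves are irrelevant to block \<open>i\<close>.\<close>

lemma map_run_pmf_queried:
  assumes "QUERY i"
  shows "map_pmf (\<lambda>(QUERY, N). (QUERY i, N i)) (run_pmf z \<mu> T V QUERY N) = return_pmf (True, N i)"
  using assms
proof (induction T arbitrary: V QUERY N)
  case (Query qu T0 T1)
  obtain k j where qu: "qu = (k, j)" by force
  let ?\<pi> = "\<lambda>(QUERY, N). (QUERY i, N i)"
  let ?go = "\<lambda>zero. if zero then run_pmf z \<mu> T0 (V(k := {x \<in> V k. \<not> x j}))
    else run_pmf z \<mu> T1 (V(k := {x \<in> V k. x j}))"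
  have go: "map_pmf ?\<pi> (?go zero QUERY' N') = return_pmf (True, N' i)" if "QUERY' i" for zero QUERY' N'
    using Query.IH that by (cases zero) simp_all
  show ?case
  proof (cases "QUERY k")
    case True
    then show ?thesis
      using Query.prems by (simp add: qu Let_def map_bind_pmf go)
  next
    case False
    then have "k \<noteq> i" using Query.prems by auto
    with False show ?thesis
      using Query.prems by (simp add: qu Let_def map_bind_pmf go[unfolded split_beta] split_beta)
  qed
qed simp

text \<open>A query in another block moves as a Bernoulli answer whether or not that block was
  queried before, exactly as in \<open>restricted_tree\<close>. A query in block \<open>i\<close> is
  a \<open>free_step\<close>, and a conflict there freezes the outcome.\<close>

lemma map_run_pmf_unqueried:
  assumes "\<not> QUERY i"
  shows "map_pmf (\<lambda>(QUERY, N). (QUERY i, N i)) (run_pmf z \<mu> T V QUERY N) =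
    restricted_tree z \<mu> i T V \<bind> (\<lambda>C. conflict_run (\<mu> i) C (V i) (N i))"
  using assms
proof (induction T arbitrary: V QUERY N)
  case Leaf
  then show ?case by (simp add: bind_return_pmf)
next
  case (Query qu T0 T1)
  obtain k j where qu: "qu = (k, j)" by force
  let ?\<pi> = "\<lambda>(QUERY, N). (QUERY i, N i)"
  let ?q = "\<lambda>b. prob_zero (side (\<mu> k) b) j (V k)"
  let ?V0 = "V(k := {x \<in> V k. \<not> x j})" and ?V1 = "V(k := {x \<in> V k. x j})"
  let ?R0 = "restricted_tree z \<mu> i T0" and ?R1 = "restricted_tree z \<mu> i T1"
  have q: "?q (z k) \<in> {?q False, ?q True}"
    by (cases "z k") auto
  consider (own) "k = i" | (fresh) "k \<noteq> i" "\<not> QUERY k" | (queried) "k \<noteq> i" "QUERY k"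
    by blast
  then show ?case
  proof cases
    case own
    let ?W0 = "{x \<in> V i. \<not> x j}" and ?W1 = "{x \<in> V i. x j}" and ?n = "Suc (N i)"
    let ?G = "\<lambda>C0 C1 s. case s of None \<Rightarrow> return_pmf (True, ?n)
      | Some b \<Rightarrow> if b then conflict_run (\<mu> i) C1 ?W1 ?n else conflict_run (\<mu> i) C0 ?W0 ?n"
    let ?S = "query_step (?q False) (?q True) (?q (z i))"
    let ?F = "free_step (?q False) (?q True)"
    have "map_pmf ?\<pi> (run_pmf z \<mu> (Query qu T0 T1) V QUERY N) =
      ?S \<bind> (\<lambda>(c, zero). if c then return_pmf (True, ?n)
        else if zero then ?R0 V \<bind> (\<lambda>C. conflict_run (\<mu> i) C ?W0 ?n)
        else ?R1 V \<bind> (\<lambda>C. conflict_run (\<mu> i) C ?W1 ?n))"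
      using Query.prems own
      by (auto simp: qu Let_def map_bind_pmf Query.IH map_run_pmf_queried
          intro!: bind_pmf_cong)
    also have "\<dots> = ?S \<bind> (\<lambda>(c, zero). ?R0 V \<bind> (\<lambda>C0. ?R1 V \<bind>
        (\<lambda>C1. ?G C0 C1 (if c then None else Some (\<not> zero)))))"
      by (auto intro!: bind_pmf_cong)
    also have "\<dots> = ?F \<bind> (\<lambda>s. ?R0 V \<bind> (\<lambda>C0. ?R1 V \<bind> (\<lambda>C1. ?G C0 C1 s)))"
    proof -
      have "map_pmf (\<lambda>(c, zero). if c then None else Some (\<not> zero)) ?S = ?F"
        using q own by (intro map_query_step_eq_free_step) simp
      from this[symmetric] show ?thesis
        by (simp only: bind_map_pmf split_def)
    qed
    \<comment> \<open>The subtree draws do not depend on \<open>s\<close> and can be moved in front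
      of the step.\<close>
    also have "\<dots> = ?R0 V \<bind> (\<lambda>C0. ?F \<bind> (\<lambda>s. ?R1 V \<bind> (\<lambda>C1. ?G C0 C1 s)))"
      by (rule bind_commute_pmf)
    also have "\<dots> = ?R0 V \<bind> (\<lambda>C0. ?R1 V \<bind> (\<lambda>C1. ?F \<bind> ?G C0 C1))"
      by (subst bind_commute_pmf) simp
    also have "\<dots> = restricted_tree z \<mu> i (Query qu T0 T1) V \<bind>
        (\<lambda>C. conflict_run (\<mu> i) C (V i) (N i))"
      using own by (simp add: qu bind_assoc_pmf bind_return_pmf side_def)
    finally show ?thesis .
  next
    case fresh
    let ?H = "\<lambda>zero. if zero then ?R0 ?V0 \<bind> (\<lambda>C. conflict_run (\<mu> i) C (V i) (N i))
        else ?R1 ?V1 \<bind> (\<lambda>C. conflict_run (\<mu> i) C (V i) (N i))"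
    have "map_pmf ?\<pi> (run_pmf z \<mu> (Query qu T0 T1) V QUERY N) =
      query_step (?q False) (?q True) (?q (z k)) \<bind> (\<lambda>s. ?H (snd s))"
      using Query.prems fresh
      by (auto simp: qu Let_def map_bind_pmf Query.IH intro!: bind_pmf_cong)
    also have "\<dots> = map_pmf snd (query_step (?q False) (?q True) (?q (z k))) \<bind> ?H"
      by (simp add: bind_map_pmf)
    also have "\<dots> = bernoulli_pmf (?q (z k)) \<bind> ?H"
      by (simp add: map_snd_query_step prob_zero_bounds)
    also have "\<dots> = restricted_tree z \<mu> i (Query qu T0 T1) V \<bind>
        (\<lambda>C. conflict_run (\<mu> i) C (V i) (N i))"
      using fresh by (auto simp: qu bind_assoc_pmf intro!: bind_pmf_cong)
    finally show ?thesis .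
  next
    case queried
    then show ?thesis
      using Query.prems
      by (auto simp: qu Let_def map_bind_pmf bind_assoc_pmf Query.IH intro!: bind_pmf_cong)
  qed
qed

definition block_tree :: "('t::finite \<times> 'm) decision_tree \<Rightarrow> ('m dist \<times> 'm dist) pmf \<Rightarrow>
    ('t \<Rightarrow> bool) \<Rightarrow> 't \<Rightarrow> 'm decision_tree pmf" where
  "block_tree B Q z i = Pi_pmf (UNIV - {i}) undefined (\<lambda>_. Q) \<bind>
     (\<lambda>\<mu>. restricted_tree z \<mu> i B (\<lambda>_. UNIV))"

lemma map_process_pmf:
  "map_pmf (\<lambda>(QUERY, N). (QUERY i, N i)) (process_pmf B Q z) =
    block_tree B Q z i \<bind> (\<lambda>C. Q \<bind> (\<lambda>P. conflict_run P C UNIV 0))"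
proof -
  let ?Pi = "Pi_pmf (UNIV - {i}) undefined (\<lambda>_. Q)"
  \<comment> \<open>The pair of block \<open>i\<close> is separated from the independent pairs of
    the other blocks.\<close>
  have split: "Pi_pmf UNIV undefined (\<lambda>_. Q) = Q \<bind> (\<lambda>P. ?Pi \<bind> (\<lambda>\<mu>. return_pmf (\<mu>(i := P))))"
    using Pi_pmf_insert'[of "UNIV - {i}" i undefined "\<lambda>_. Q"] by (simp add: insert_absorb)
  have "map_pmf (\<lambda>(QUERY, N). (QUERY i, N i)) (process_pmf B Q z) =
    Q \<bind> (\<lambda>P. ?Pi \<bind> (\<lambda>\<mu>. restricted_tree z \<mu> i B (\<lambda>_. UNIV) \<bind>
      (\<lambda>C. conflict_run P C UNIV 0)))"
    by (simp add: process_pmf_def split map_bind_pmf bind_assoc_pmf bind_return_pmf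
        map_run_pmf_unqueried)
  also have "\<dots> = Q \<bind> (\<lambda>P. block_tree B Q z i \<bind> (\<lambda>C. conflict_run P C UNIV 0))"
    by (simp add: block_tree_def bind_assoc_pmf)
  also have "\<dots> = block_tree B Q z i \<bind> (\<lambda>C. Q \<bind> (\<lambda>P. conflict_run P C UNIV 0))"
    by (rule bind_commute_pmf)
  finally show ?thesis .
qed


section \<open>Recursive evaluation of the conflict sums\<close>

text \<open>The factor that \<open>R_at\<close> acquires along the edge with answer
  \<open>b\<close>.\<close>

definition min_prob :: "'m dist \<times> 'm dist \<Rightarrow> 'm \<Rightarrow> bool \<Rightarrow> ('m \<Rightarrow> bool) set \<Rightarrow> real" where
  "min_prob P j b V = min (\<P>(x in measure_pmf (fst P). x j = b \<bar> x \<in> V))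
     (\<P>(x in measure_pmf (snd P). x j = b \<bar> x \<in> V))"

definition charged :: "'m dist \<times> 'm dist \<Rightarrow> ('m \<Rightarrow> bool) set \<Rightarrow> bool" where
  "charged P V \<longleftrightarrow> measure_pmf.prob (fst P) V > 0 \<and> measure_pmf.prob (snd P) V > 0"

lemma charged_UNIV [simp]: "charged P UNIV"
  by (simp add: charged_def)

lemma min_prob_nonneg: "0 \<le> min_prob P j b V"
  unfolding min_prob_def by (simp add: cond_prob_bounds)

lemma min_prob_False: "min_prob P j False V = min (prob_zero (fst P) j V) (prob_zero (snd P) j V)"
  by (simp add: min_prob_def prob_zero_def)

text \<open>On a null set both conditional probabilities are 0 by convention and would not add up to
  1.\<close>

lemma cond_prob_bit_eq:
  assumes "measure_pmf.prob \<mu> V > 0"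
  shows "\<P>(x in measure_pmf \<mu>. x j \<bar> x \<in> V) = 1 - prob_zero \<mu> j V"
proof -
  have "V = {x. x j \<and> x \<in> V} \<union> {x. \<not> x j \<and> x \<in> V}"
    by auto
  then have "measure_pmf.prob \<mu> V =
      measure_pmf.prob \<mu> {x. x j \<and> x \<in> V} + measure_pmf.prob \<mu> {x. \<not> x j \<and> x \<in> V}"
    by (metis (no_types, lifting) measure_pmf.finite_measure_Union disjoint_iff mem_Collect_eq
        sets_measure_pmf UNIV_I)
  with assms show ?thesis
    by (simp add: prob_zero_def cond_prob_def field_simps)
qed

lemma min_prob_True:
  assumes "charged P V"
  shows "min_prob P j True V = 1 - max (prob_zero (fst P) j V) (prob_zero (snd P) j V)"
  using assms by (simp add: min_prob_def charged_def cond_prob_bit_eq)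

text \<open>A nonzero minimum makes both conditional probabilities positive. Inductions can thus
  assume \<open>charged\<close> on every branch whose weight does not vanish.\<close>

lemma charged_restrict:
  assumes "min_prob P j b V \<noteq> 0"
  shows "charged P {x \<in> V. x j = b}"
proof -
  have *: "measure_pmf.prob \<mu> {x \<in> V. x j = b} > 0"
    if "\<P>(x in measure_pmf \<mu>. x j = b \<bar> x \<in> V) > 0" for \<mu>
    using that by (auto simp: cond_prob_def zero_less_divide_iff conj_commute not_less measure_le_0_iff)
  have "min_prob P j b V > 0"
    using assms min_prob_nonneg[of P j b V] by simp
  then show ?thesis
    unfolding charged_def min_prob_def by (auto intro!: *)
qed

text \<open>The sum of \<open>f (n + depth v) * Delta * R\<close> over the vertices, computed from
  the root. Constant 1 for \<open>f\<close> tests fullness; \<open>real\<close> gives the conflict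
  complexity.\<close>

fun conflict_sum :: "(nat \<Rightarrow> real) \<Rightarrow> 'm dist \<times> 'm dist \<Rightarrow> 'm decision_tree \<Rightarrow>
    ('m \<Rightarrow> bool) set \<Rightarrow> nat \<Rightarrow> real" where
  "conflict_sum f P Leaf V n = 0"
| "conflict_sum f P (Query j C0 C1) V n =
     f (Suc n) * \<bar>prob_zero (fst P) j V - prob_zero (snd P) j V\<bar>
     + min_prob P j False V * conflict_sum f P C0 {x \<in> V. \<not> x j} (Suc n)
     + min_prob P j True V * conflict_sum f P C1 {x \<in> V. x j} (Suc n)"

lemma finite_set_conflict_run [simp]: "finite (set_pmf (conflict_run P C V n))"
  by (induction C arbitrary: V n) (auto split: option.splits)

lemma expectation_conflict_run:
  assumes "charged P V"
  shows "measure_pmf.expectation (conflict_run P C V n) (\<lambda>(c, k). if c then f k else 0) =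
    conflict_sum f P C V n"
  using assms
proof (induction C arbitrary: V n)
  case (Query j C0 C1)
  let ?p = "prob_zero (fst P) j V" and ?q = "prob_zero (snd P) j V"
  let ?E = "\<lambda>M. measure_pmf.expectation M (\<lambda>(c, k). if c then f k else 0)"
  have *: "min_prob P j b V * ?E (conflict_run P C {x \<in> V. x j = b} (Suc n)) =
      min_prob P j b V * conflict_sum f P C {x \<in> V. x j = b} (Suc n)" if "C \<in> {C0, C1}" for b C
    using Query.IH that charged_restrict[of P j b V] by (cases "min_prob P j b V = 0") auto
  have "?E (conflict_run P (Query j C0 C1) V n) =
    (\<Sum>s\<in>UNIV. pmf (free_step ?p ?q) s *\<^sub>R ?E (case s of
        None \<Rightarrow> return_pmf (True, Suc n)
      | Some b \<Rightarrow> if b then conflict_run P C1 {x \<in> V. x j} (Suc n)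
                  else conflict_run P C0 {x \<in> V. \<not> x j} (Suc n)))"
    unfolding conflict_run.simps by (rule pmf_expectation_bind) (auto split: option.splits)
  also have "\<dots> = conflict_sum f P (Query j C0 C1) V n"
    using *[of C0 False] *[of C1 True] Query.prems
    by (auto simp: UNIV_option_conv UNIV_bool pmf_free_step prob_zero_bounds min_prob_False
        min_prob_True)
  finally show ?case .
qed simp

lemma conflict_run_bounded: "s \<in> set_pmf (conflict_run P C V n) \<Longrightarrow> snd s \<le> n + size C"
proof (induction C arbitrary: V n)
  case (Query j C0 C1)
  from Query.prems consider "s = (True, Suc n)"
    | "s \<in> set_pmf (conflict_run P C1 {x \<in> V. x j} (Suc n))"
    | "s \<in> set_pmf (conflict_run P C0 {x \<in> V. \<not> x j} (Suc n))"
    by (auto split: option.splits if_splits)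
  then show ?case
    by cases (auto dest: Query.IH)
qed simp

text \<open>A version of \<open>R_at\<close> that peels off the first answer instead of the last, to
  match the recursion of \<open>conflict_sum\<close>; \<open>V\<close> is the cube already
  reached.\<close>

fun path_weight :: "'m dist \<times> 'm dist \<Rightarrow> 'm decision_tree \<Rightarrow> ('m \<Rightarrow> bool) set \<Rightarrow> bool list \<Rightarrow> real"
  where
  "path_weight P T V [] = 1"
| "path_weight P Leaf V (b # v) = 0"
| "path_weight P (Query j T0 T1) V (b # v) =
     min_prob P j b V * path_weight P (if b then T1 else T0) {x \<in> V. x j = b} v"

text \<open>The last edge contributes the factor from the definition of \<open>R_at\<close>. In the
  induction the first answer is absorbed into \<open>V\<close>.\<close>

lemma path_weight_snoc:
  "path_weight P T V (v @ [b]) = path_weight P T V v *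
     min (\<P>(x in measure_pmf (fst P). x \<in> subcube T (v @ [b]) \<bar> x \<in> V \<inter> subcube T v))
         (\<P>(x in measure_pmf (snd P). x \<in> subcube T (v @ [b]) \<bar> x \<in> V \<inter> subcube T v))"
proof (induction v arbitrary: T V)
  case Nil
  show ?case
    by (cases T) (auto simp: min_prob_def cond_prob_def)
next
  case (Cons c v)
  show ?case
  proof (cases T)
    case Leaf
    then show ?thesis by simp
  next
    case (Query j T0 T1)
    let ?T = "if c then T1 else T0"
    have "\<P>(x in measure_pmf \<mu>. x \<in> subcube ?T (v @ [b]) \<bar> x \<in> {x \<in> V. x j = c} \<inter> subcube ?T v) =
      \<P>(x in measure_pmf \<mu>. x \<in> subcube T ((c # v) @ [b]) \<bar> x \<in> V \<inter> subcube T (c # v))" for \<mu>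
      unfolding cond_prob_def Query
      by (intro arg_cong2[where f = "(/)"] arg_cong[where f = "measure (measure_pmf \<mu>)"]) auto
    then show ?thesis
      using Cons.IH[of ?T "{x \<in> V. x j = c}"] by (simp add: Query)
  qed
qed

lemma R_at_eq_path_weight: "R_at C P v = path_weight P C UNIV v"
proof (induction v rule: rev_induct)
  case Nil
  show ?case by (simp add: R_at.simps)
next
  case (snoc b v)
  then show ?case
    by (subst R_at.simps) (simp add: path_weight_snoc)
qed

section \<open>Vertex sums and their recursive form\<close>

lemma finite_internal_vertices [simp]: "finite (internal_vertices T)"
  by (induction T) auto

lemma sum_internal_vertices_eq_conflict_sum:
  "(\<Sum>v\<in>internal_vertices T. f (n + depth v) *
      \<bar>prob_zero (fst P) (query_at T v) (V \<inter> subcube T v) -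
       prob_zero (snd P) (query_at T v) (V \<inter> subcube T v)\<bar> * path_weight P T V v) =
    conflict_sum f P T V n"
proof (induction T arbitrary: V n)
  case (Query j T0 T1)
  let ?F = "\<lambda>T V n v. f (n + depth v) *
      \<bar>prob_zero (fst P) (query_at T v) (V \<inter> subcube T v) -
       prob_zero (snd P) (query_at T v) (V \<inter> subcube T v)\<bar> * path_weight P T V v"
  let ?T = "Query j T0 T1"
  have step: "(\<Sum>v\<in>(#) b ` internal_vertices T. ?F ?T V n v) =
      min_prob P j b V * conflict_sum f P T {x \<in> V. x j = b} (Suc n)"
    if T: "T = (if b then T1 else T0)" for b T
  proof -
    \<comment> \<open>Prefixing an answer adds one to the depth, which the shift from
      \<open>n\<close> to \<open>Suc n\<close> records.\<close>
    have "?F ?T V n (b # v) = min_prob P j b V * ?F T {x \<in> V. x j = b} (Suc n) v" for v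
    proof -
      have "V \<inter> ({x. x j = b} \<inter> subcube T v) = {x \<in> V. x j = b} \<inter> subcube T v"
        by auto
      then show ?thesis
        by (simp add: T[symmetric] depth_def)
    qed
    then have "(\<Sum>v\<in>(#) b ` internal_vertices T. ?F ?T V n v) =
        min_prob P j b V * (\<Sum>v\<in>internal_vertices T. ?F T {x \<in> V. x j = b} (Suc n) v)"
      by (subst sum.reindex) (auto simp: sum_distrib_left simp del: query_at.simps subcube.simps path_weight.simps)
    also have "(\<Sum>v\<in>internal_vertices T. ?F T {x \<in> V. x j = b} (Suc n) v) =
        conflict_sum f P T {x \<in> V. x j = b} (Suc n)"
      using Query.IH(1)[where V = "{x \<in> V. x j = b}" and n = "Suc n"]
        Query.IH(2)[where V = "{x \<in> V. x j = b}" and n = "Suc n"] T by (cases b) simp_all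
    finally show ?thesis .
  qed
  have "(\<Sum>v\<in>internal_vertices ?T. ?F ?T V n v) =
      ?F ?T V n [] + ((\<Sum>v\<in>(#) False ` internal_vertices T0. ?F ?T V n v) +
        (\<Sum>v\<in>(#) True ` internal_vertices T1. ?F ?T V n v))"
    unfolding internal_vertices.simps
    by (subst sum.insert, simp, force, subst sum.union_disjoint) auto
  also have "\<dots> = conflict_sum f P ?T V n"
    using step[of T0 False] step[of T1 True] by (simp add: depth_def)
  finally show ?case .
qed simp

lemma pair_full_iff_conflict_sum: "pair_full C P \<longleftrightarrow> conflict_sum (\<lambda>_. 1) P C UNIV 0 = 1"
  unfolding pair_full_def
  using sum_internal_vertices_eq_conflict_sum[of "\<lambda>_. 1" 0 P C UNIV]
  by (simp add: Delta_def p_at_def R_at_eq_path_weight)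

lemma pair_chi_eq_conflict_sum: "pair_chi C P = conflict_sum real P C UNIV 0"
  unfolding pair_chi_def
  using sum_internal_vertices_eq_conflict_sum[of real 0 P C UNIV]
  by (simp add: Delta_def p_at_def R_at_eq_path_weight)

text \<open>The conflict complexity counts the queries up to and including the conflict; runs
  without a conflict contribute 0.\<close>

lemma pair_chi_eq_expectation:
  "pair_chi C P =
    measure_pmf.expectation (conflict_run P C UNIV 0) (\<lambda>(c, k). if c then real k else 0)"
  by (simp add: pair_chi_eq_conflict_sum expectation_conflict_run)

lemma pair_chi_nonneg: "0 \<le> pair_chi C P"
  unfolding pair_chi_eq_expectation by (rule integral_nonneg_AE) (auto simp: split_beta)

lemma pair_chi_le_size: "pair_chi C P \<le> real (size C)"
  unfolding pair_chi_eq_expectation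
  by (intro measure_pmf.integral_le_const integrable_measure_pmf_finite)
    (auto simp: AE_measure_pmf_iff dest: conflict_run_bounded)

lemma integrable_pair_chi: "integrable (measure_pmf Q) (pair_chi C)"
  by (rule measure_pmf.integrable_const_bound[where B = "real (size C)"])
    (auto simp: pair_chi_nonneg pair_chi_le_size)


section \<open>Existence of an optimal tree\<close>

fun prune :: "('m \<Rightarrow> bool) set \<Rightarrow> 'm decision_tree \<Rightarrow> 'm decision_tree" where
  "prune V Leaf = Leaf"
| "prune V (Query j C0 C1) =
    (if \<forall>x\<in>V. \<not> x j then prune V C0 else if \<forall>x\<in>V. x j then prune V C1
     else Query j (prune {x \<in> V. \<not> x j} C0) (prune {x \<in> V. x j} C1))"

section \<open>Finiteness of the set of pruned trees\<close>

fun tree_height :: "'q decision_tree \<Rightarrow> nat" where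
  "tree_height Leaf = 0"
| "tree_height (Query q T0 T1) = Suc (max (tree_height T0) (tree_height T1))"

lemma finite_height_le: "finite {T :: 'q::finite decision_tree. tree_height T \<le> n}"
proof (induction n)
  case 0
  have "{T :: 'q decision_tree. tree_height T \<le> 0} \<subseteq> {Leaf}"
  proof
    fix T :: "'q decision_tree"
    assume "T \<in> {T. tree_height T \<le> 0}"
    then show "T \<in> {Leaf}" by (cases T) auto
  qed
  then show ?case by (rule finite_subset) simp
next
  case (Suc n)
  let ?S = "{T :: 'q decision_tree. tree_height T \<le> n}"
  have "{T :: 'q decision_tree. tree_height T \<le> Suc n} \<subseteq>
      insert Leaf ((\<lambda>(q, T0, T1). Query q T0 T1) ` (UNIV \<times> ?S \<times> ?S))"
  proof
    fix T :: "'q decision_tree"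
    assume "T \<in> {T. tree_height T \<le> Suc n}"
    then show "T \<in> insert Leaf ((\<lambda>(q, T0, T1). Query q T0 T1) ` (UNIV \<times> ?S \<times> ?S))"
      by (cases T) force+
  qed
  then show ?case
    by (rule finite_subset) (use Suc in simp)
qed

text \<open>Every surviving query splits \<open>V\<close> into two nonempty parts, so the
  cardinality drops strictly along each path.\<close>

lemma height_prune: "tree_height (prune V C) \<le> card (V :: ('m::finite \<Rightarrow> bool) set)"
proof (induction C arbitrary: V)
  case (Query j C0 C1)
  have "card {x \<in> V. \<not> x j} < card V" if "\<not> (\<forall>x\<in>V. \<not> x j)"
    using that by (intro psubset_card_mono) auto
  moreover have "card {x \<in> V. x j} < card V" if "\<not> (\<forall>x\<in>V. x j)"
    using that by (intro psubset_card_mono) auto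
  ultimately show ?case
    using Query.IH(1)[of V] Query.IH(2)[of V]
      Query.IH(1)[of "{x \<in> V. \<not> x j}"] Query.IH(2)[of "{x \<in> V. x j}"]
    by (auto simp: Suc_le_eq intro: le_less_trans)
qed simp

section \<open>The effect of pruning on conflict sums\<close>

lemma conflict_sum_Suc:
  assumes "mono f"
  shows "conflict_sum f P C V n \<le> conflict_sum f P C V (Suc n)"
proof (induction C arbitrary: V n)
  case (Query j C0 C1)
  have "f (Suc n) \<le> f (Suc (Suc n))"
    using assms by (simp add: mono_def)
  then show ?case
    using Query.IH by (auto intro!: add_mono mult_left_mono mult_right_mono min_prob_nonneg)
qed simp

text \<open>A determined query has no conflict mass and passes full weight to one child, so all it
  does is raise the depth by one.\<close>

lemma conflict_sum_const_query:
  assumes "charged P V" "\<forall>x\<in>V. x j = b"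
  shows "conflict_sum f P (Query j C0 C1) V n = conflict_sum f P (if b then C1 else C0) V (Suc n)"
proof -
  have pz: "prob_zero \<mu> j V = (if b then 0 else 1)" if "measure_pmf.prob \<mu> V > 0" for \<mu>
  proof -
    have "{x. \<not> x j \<and> x \<in> V} = (if b then {} else V)"
      using assms(2) by auto
    then show ?thesis
      using that by (simp add: prob_zero_def cond_prob_def)
  qed
  have V: "{x \<in> V. x j = b} = V"
    using assms(2) by auto
  show ?thesis
    using assms(1) V by (cases b) (simp_all add: min_prob_False min_prob_True pz charged_def)
qed

text \<open>Deleting determined queries only lowers depths, and \<open>f\<close> is
  monotone.\<close>

lemma conflict_sum_prune_le:
  assumes "mono f" "charged P V"
  shows "conflict_sum f P (prune V C) V n \<le> conflict_sum f P C V n"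
  using assms(2)
proof (induction C arbitrary: V n)
  case (Query j C0 C1)
  have const: "conflict_sum f P (prune V (if b then C1 else C0)) V n \<le>
      conflict_sum f P (Query j C0 C1) V n" if "\<forall>x\<in>V. x j = b" for b
  proof -
    have "conflict_sum f P (prune V (if b then C1 else C0)) V n \<le>
        conflict_sum f P (if b then C1 else C0) V n"
      using Query.IH Query.prems by (cases b) simp_all
    also have "\<dots> \<le> conflict_sum f P (if b then C1 else C0) V (Suc n)"
      by (rule conflict_sum_Suc) fact
    finally show ?thesis
      by (simp only: conflict_sum_const_query[OF Query.prems that])
  qed
  have branch: "min_prob P j b V * conflict_sum f P (prune {x \<in> V. x j = b} C) {x \<in> V. x j = b} (Suc n)
      \<le> min_prob P j b V * conflict_sum f P C {x \<in> V. x j = b} (Suc n)" if "C \<in> {C0, C1}" for b C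
    using Query.IH that charged_restrict[of P j b V]
    by (cases "min_prob P j b V = 0") (auto intro!: mult_left_mono min_prob_nonneg)
  show ?case
    using const[of False] const[of True] branch[of C0 False] branch[of C1 True] by auto
qed simp

lemma pair_full_prune:
  assumes "pair_full C P"
  shows "pair_full (prune UNIV C) P"
proof -
  \<comment> \<open>Constant functions are monotone, so the two signs give both inequalities.\<close>
  have neg: "conflict_sum (\<lambda>_. -1) P T V n = - conflict_sum (\<lambda>_. 1) P T V n" for T V n
    by (induction T arbitrary: V n) (simp_all add: algebra_simps)
  show ?thesis
    using assms conflict_sum_prune_le[of "\<lambda>_. 1" P UNIV C 0]
      conflict_sum_prune_le[of "\<lambda>_. -1" P UNIV C 0]
    by (simp add: pair_full_iff_conflict_sum neg mono_def)
qed

lemma chi_prune_le: "chi (prune UNIV C) Q \<le> chi C Q"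
  unfolding chi_def
  by (intro integral_mono integrable_pair_chi)
    (auto simp: pair_chi_eq_conflict_sum mono_def intro: conflict_sum_prune_le)

text \<open>Each full tree has a pruned full competitor that is no worse, so a minimum over the
  finitely many trees of bounded height is global. The given \<open>C\<close> makes this set
  nonempty.\<close>

lemma ex_arg_min_chi:
  fixes Q :: "('m::finite dist \<times> 'm dist) pmf"
  assumes "full C Q"
  shows "\<exists>C\<^sub>m\<^sub>i\<^sub>n. is_arg_min (\<lambda>C. chi C Q) (\<lambda>C. full C Q) C\<^sub>m\<^sub>i\<^sub>n"
proof -
  let ?S = "{C. full C Q \<and> tree_height C \<le> card (UNIV :: ('m \<Rightarrow> bool) set)}"
  have pruned: "prune UNIV D \<in> ?S" if "full D Q" for D
    using that height_prune[of UNIV D] by (auto simp: full_def pair_full_prune)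
  have "finite ?S"
    by (rule finite_subset[OF _ finite_height_le]) auto
  moreover have "?S \<noteq> {}"
    using pruned[OF assms] by blast
  ultimately obtain D where D: "D \<in> ?S" "\<And>E. E \<in> ?S \<Longrightarrow> chi D Q \<le> chi E Q"
    using arg_min_if_finite(1)[of ?S "\<lambda>C. chi C Q"] arg_min_least[of ?S _ "\<lambda>C. chi C Q"] by blast
  have "chi D Q \<le> chi E Q" if "full E Q" for E
    using D(2)[OF pruned[OF that]] chi_prune_le[of E Q] by linarith
  then show ?thesis
    using D(1) by (auto simp: is_arg_min_def not_less)
qed


section \<open>The direct sum bound\<close>

text \<open>Querying with probability 1 means that every outcome in the support is a conflict. The
  support of a mixture is the union of the supports, so this passes to each single tree and
  pair.\<close>

lemma full_block_tree:
  assumes "process_full B Q" "C \<in> set_pmf (block_tree B Q z i)"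
  shows "full C Q"
  unfolding full_def
proof
  fix P assume P: "P \<in> set_pmf Q"
  have "measure_pmf.prob (process_pmf B Q z) {(QUERY, N). QUERY i} = 1"
    using assms(1) by (auto simp: process_full_def query_process_eq_process_pmf)
  then have "AE s in measure_pmf (process_pmf B Q z). s \<in> {(QUERY, N). QUERY i}"
    by (subst (asm) measure_pmf.prob_eq_1) auto
  then have "fst s" if "s \<in> set_pmf (map_pmf (\<lambda>(QUERY, N). (QUERY i, N i)) (process_pmf B Q z))" for s
    using that by (auto simp: AE_measure_pmf_iff)
  then have "fst s" if "s \<in> set_pmf (conflict_run P C UNIV 0)" for s
    using that assms(2) P unfolding map_process_pmf set_bind_pmf by blast
  then have "measure_pmf.expectation (conflict_run P C UNIV 0) (\<lambda>(c, k). if c then 1 else 0) =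
      measure_pmf.expectation (conflict_run P C UNIV 0) (\<lambda>_. 1 :: real)"
    by (intro integral_cong_AE) (auto simp: AE_measure_pmf_iff)
  then show "pair_full C P"
    by (simp add: pair_full_iff_conflict_sum flip: expectation_conflict_run)
qed

lemma size_restricted_tree:
  "C \<in> set_pmf (restricted_tree z \<mu> i T V) \<Longrightarrow> size C \<le> size T"
proof (induction T arbitrary: V C)
  case (Query qu T0 T1)
  obtain k j where qu: "qu = (k, j)" by force
  show ?case
  proof (cases "k = i")
    case True
    with Query.prems obtain C0 C1 where "C = Query j C0 C1"
      "C0 \<in> set_pmf (restricted_tree z \<mu> i T0 V)" "C1 \<in> set_pmf (restricted_tree z \<mu> i T1 V)"
      by (auto simp: qu)
    then show ?thesis
      using Query.IH by (auto intro: add_mono)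
  next
    case False
    with Query.prems obtain W where
      "C \<in> set_pmf (restricted_tree z \<mu> i T0 W) \<or> C \<in> set_pmf (restricted_tree z \<mu> i T1 W)"
      by (auto simp: qu split: if_splits)
    then show ?thesis
      by (auto dest: Query.IH)
  qed
qed simp

text \<open>\<open>N\<close> also counts runs that end without a conflict, so it dominates the
  quantity averaged in \<open>chi\<close>. Trees and pairs may have infinite support; nonnegative
  integrals allow the mixture to be unfolded without integrability conditions.\<close>

lemma expected_N_ge:
  assumes "\<And>C. C \<in> set_pmf (block_tree B Q z i) \<Longrightarrow> c \<le> chi C Q"
  shows "c \<le> expected_N B z Q i"
proof -
  let ?D = "block_tree B Q z i"
  let ?W = "?D \<bind> (\<lambda>C. Q \<bind> (\<lambda>P. conflict_run P C UNIV 0))"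
  have bound: "snd s \<le> size B" if s: "s \<in> set_pmf ?W" for s
  proof -
    from s obtain C P \<mu> where "s \<in> set_pmf (conflict_run P C UNIV 0)"
      "C \<in> set_pmf (restricted_tree z \<mu> i B (\<lambda>_. UNIV))"
      by (auto simp: block_tree_def)
    from conflict_run_bounded[OF this(1)] size_restricted_tree[OF this(2)] show ?thesis
      by simp
  qed
  have int: "integrable (measure_pmf ?W) (\<lambda>s. real (snd s))"
    by (rule measure_pmf.integrable_const_bound[where B = "real (size B)"])
      (use bound in \<open>auto simp: AE_measure_pmf_iff\<close>)
  have chi: "ennreal (chi C Q) \<le> (\<integral>\<^sup>+P. \<integral>\<^sup>+s. ennreal (real (snd s)) \<partial>conflict_run P C UNIV 0 \<partial>Q)" for C
  proof -
    have "ennreal (chi C Q) = (\<integral>\<^sup>+P. ennreal (pair_chi C P) \<partial>Q)"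
      unfolding chi_def
      by (rule nn_integral_eq_integral[symmetric]) (auto simp: integrable_pair_chi pair_chi_nonneg)
    also have "\<dots> \<le> (\<integral>\<^sup>+P. \<integral>\<^sup>+s. ennreal (real (snd s)) \<partial>conflict_run P C UNIV 0 \<partial>Q)"
    proof (rule nn_integral_mono)
      fix P
      have "ennreal (pair_chi C P) =
          (\<integral>\<^sup>+s. ennreal (case s of (c, k) \<Rightarrow> if c then real k else 0) \<partial>conflict_run P C UNIV 0)"
        unfolding pair_chi_eq_expectation
        by (rule nn_integral_eq_integral[symmetric])
          (auto intro: integrable_measure_pmf_finite simp: split_beta)
      also have "\<dots> \<le> (\<integral>\<^sup>+s. ennreal (real (snd s)) \<partial>conflict_run P C UNIV 0)"
        by (rule nn_integral_mono) (auto simp: split_beta)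
      finally show "ennreal (pair_chi C P) \<le> \<dots>" .
    qed
    finally show ?thesis .
  qed
  have "ennreal c = (\<integral>\<^sup>+C. ennreal c \<partial>?D)"
    by simp
  also have "\<dots> \<le> (\<integral>\<^sup>+C. \<integral>\<^sup>+P. \<integral>\<^sup>+s. ennreal (real (snd s)) \<partial>conflict_run P C UNIV 0 \<partial>Q \<partial>?D)"
    by (rule nn_integral_mono_AE)
      (auto simp: AE_measure_pmf_iff intro!: order_trans[OF _ chi] ennreal_leI assms)
  also have "\<dots> = (\<integral>\<^sup>+s. ennreal (real (snd s)) \<partial>?W)"
    by simp
  also have "\<dots> = ennreal (measure_pmf.expectation ?W (\<lambda>s. real (snd s)))"
    by (rule nn_integral_eq_integral[OF int]) simp
  also have "measure_pmf.expectation ?W (\<lambda>s. real (snd s)) = expected_N B z Q i"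
    by (simp add: expected_N_def query_process_eq_process_pmf case_prod_unfold
        flip: map_process_pmf)
  finally have "ennreal c \<le> ennreal (expected_N B z Q i)" .
  \<comment> \<open>\<open>ennreal\<close> truncates negative reals, so the right-hand side must be
    nonnegative before returning to the reals.\<close>
  moreover have "0 \<le> expected_N B z Q i"
    unfolding expected_N_def by (rule integral_nonneg_AE) (auto simp: split_beta)
  ultimately show ?thesis
    by simp
qed

theorem theorem10:
  fixes B :: "('t::finite \<times> 'm::finite) decision_tree"
    and Q :: "('m dist \<times> 'm dist) pmf"
  assumes "consistent Q"
    and "process_full B Q"
  shows "\<exists>C\<^sub>m\<^sub>i\<^sub>n. is_arg_min (\<lambda>C. chi C Q) (\<lambda>C. full C Q) C\<^sub>m\<^sub>i\<^sub>n \<and>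
           (\<forall>z. (\<Sum>i\<in>UNIV. expected_N B z Q i) \<ge> real CARD('t) * chi C\<^sub>m\<^sub>i\<^sub>n Q)"
proof -
  \<comment> \<open>The input and the block are arbitrary here: any tree in the support witnesses
    that full trees exist.\<close>
  obtain C where "C \<in> set_pmf (block_tree B Q (\<lambda>_. False) undefined)"
    using set_pmf_not_empty by fast
  then have "full C Q"
    by (rule full_block_tree[OF assms(2)])
  then obtain C\<^sub>m\<^sub>i\<^sub>n where min: "is_arg_min (\<lambda>C. chi C Q) (\<lambda>C. full C Q) C\<^sub>m\<^sub>i\<^sub>n"
    using ex_arg_min_chi by blast
  \<comment> \<open>The bound holds for each block separately, so summing yields the factor
    \<open>CARD('t)\<close>.\<close>
  have "chi C\<^sub>m\<^sub>i\<^sub>n Q \<le> expected_N B z Q i" for z i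
    using min full_block_tree[OF assms(2)]
    by (intro expected_N_ge) (auto simp: is_arg_min_def not_less)
  then have "real CARD('t) * chi C\<^sub>m\<^sub>i\<^sub>n Q \<le> (\<Sum>i\<in>UNIV. expected_N B z Q i)" for z
    by (intro sum_bounded_below)
  with min show ?thesis
    by blast
qed

end
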